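(* Let $(y,\bar x,\bar v,\bar w)$ be a feasible point of the semi-coarse MILP (defined in the context). Define the fine-scale variables $x=(x_1,\dots,x_n)$, $v=(v_1,\dots,v_n)$, $w=(w_1,\dots,w_n)\in\mathbb{R}^N$ blockwise, for $i=1,\dots,n$, by $$x_i=\sum_{k=1}^K \bar x_{ik}\bar X_k,\qquad v_i=\sum_{k=1}^K\sum_{j=1}^{I_k}\bar v_{ijk}\bar V_{jk},\qquad w_i=\sum_{j=1}^J \bar w_{ij}\bar W_j .$$ Then $(y,x,v,w)$ is feasible for the original MILP (defined in the context).
   Context: All vector inequalities are componentwise. Original MILP. Let $m,N,M$ be positive integers, $a\in\mathbb{R}^m$, $b,c,d\in\mathbb{R}^N$, $f\in\mathbb{R}^M$, $A\in\mathbb{R}^{M\times m}$, $B,C,D\in\mathbb{R}^{M\times N}$, and let $L\le U$ be finite real bounds. The original MILP is: minimize $a^Ty+b^Tx+c^Tv+d^Tw$ subject to $Ay+Bx+Cv+Dw\le f$, $y\in\{0,1\}^m$, $x\in\{0,1\}^N$, $v\in\mathbb{R}^N$ with $Lx\le v\le Ux$, and $w\in\mathbb{R}^N$ with $w\ge 0$. Partition. Let $\delta$ be a positive integer with $N=n\delta$. Vectors $x,v,w,b,c,d\in\mathbb{R}^N$ are split into $n$ consecutive blocks of length $\delta$, e.g. $x=(x_1,\dots,x_n)$ with $x_i\in\mathbb{R}^\delta$. The matrices are split into column blocks, $B=[B_1:\cdots:B_n]$, $C=[C_1:\cdots:C_n]$, $D=[D_1:\cdots:D_n]$ with $B_i,C_i,D_i\in\mathbb{R}^{M\times\delta}$.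 Profiles. Fixed data: $\bar X_k\in\{0,1\}^\delta$ for $k=1,\dots,K$; for each $k$, vectors $\bar V_{jk}\in\mathbb{R}^\delta$ with $L\bar X_k\le\bar V_{jk}\le U\bar X_k$ for $j=1,\dots,I_k$; and vectors $\bar W_j\in\mathbb{R}^\delta$ with $\bar W_j\ge0$ for $j=1,\dots,J$. Let $\bar X$, $\bar V$, $\bar W$ be the matrices whose columns are, respectively, all $\bar X_k$, all $\bar V_{jk}$ (ordered by $k$, then $j$), and all $\bar W_j$. Aggregated data. $\bar B=[B_1\bar X:\cdots:B_n\bar X]$, $\bar C=[C_1\bar V:\cdots:C_n\bar V]$, $\bar D=[D_1\bar W:\cdots:D_n\bar W]$, and $\bar b=[b_1^T\bar X:\cdots:b_n^T\bar X]^T$, $\bar c=[c_1^T\bar V:\cdots:c_n^T\bar V]^T$, $\bar d=[d_1^T\bar W:\cdots:d_n^T\bar W]^T$. The coefficient vectors $\bar x=(\bar x_{ik})$, $\bar v=(\bar v_{ijk})$, $\bar w=(\bar w_{ij})$ are ordered compatibly (block $i=1,\dots,n$ first, and within a block in the order of the columns of $\bar X,\bar V,\bar W$). Semi-coarse MILP: minimize $a^Ty+\bar b^T\bar x+\bar c^T\bar v+\bar d^T\bar w$ over $(y,\bar x,\bar v,\bar w)$ subject to $Ay+\bar B\bar x+\bar C\bar v+\bar D\bar w\le f$, $y\in\{0,1\}^m$, and for all $i=1,\dots,n$: $\sum_{k=1}^K\bar x_{ik}\le1$, $\bar x_{ik}\in\{0,1\}$; $\sum_{k=1}^K\sum_{j=1}^{I_k}\bar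 v_{ijk}\le1$, $\sum_{j=1}^{I_k}\bar v_{ijk}=\bar x_{ik}$ for every $k$, $0\le\bar v_{ijk}\le1$; $\sum_{j=1}^J\bar w_{ij}\le1$, $0\le\bar w_{ij}\le1$. *)

theory Defs
  imports "Jordan_Normal_Form.Matrix"
begin

text \<open>
  Vectors and matrices are those of \<^theory>\<open>Jordan_Normal_Form.Matrix\<close>, where the order on vectors is
  componentwise and includes equality of dimensions. All indices start at 0: the blocks are
  \<open>i < n\<close>, the profiles \<open>k < K\<close>, \<open>j < I k\<close> and \<open>j < J\<close>.
\<close>

record 'p minimization =
  feasible_set :: "'p set"
  objective :: "'p \<Rightarrow> real"

definition binary_vec :: "nat \<Rightarrow> real vec set" where
  "binary_vec m = {y \<in> carrier_vec m. \<forall>i<m. y $ i \<in> {0, 1}}"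

section \<open>The original MILP\<close>

record milp_data =
  dim_y :: nat           \<comment> \<open>\<open>m\<close>\<close>
  dim_x :: nat           \<comment> \<open>\<open>N\<close>\<close>
  num_rows :: nat        \<comment> \<open>\<open>M\<close>\<close>
  cost_y :: "real vec"   \<comment> \<open>\<open>a\<close>\<close>
  cost_x :: "real vec"   \<comment> \<open>\<open>b\<close>\<close>
  cost_v :: "real vec"   \<comment> \<open>\<open>c\<close>\<close>
  cost_w :: "real vec"   \<comment> \<open>\<open>d\<close>\<close>
  mat_y :: "real mat"    \<comment> \<open>\<open>A\<close>\<close>
  mat_x :: "real mat"    \<comment> \<open>\<open>B\<close>\<close>
  mat_v :: "real mat"    \<comment> \<open>\<open>C\<close>\<close>
  mat_w :: "real mat"    \<comment> \<open>\<open>D\<close>\<close>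
  rhs :: "real vec"      \<comment> \<open>\<open>f\<close>\<close>
  lower :: real          \<comment> \<open>\<open>L\<close>\<close>
  upper :: real          \<comment> \<open>\<open>U\<close>\<close>

definition valid_milp :: "milp_data \<Rightarrow> bool" where
  "valid_milp P \<longleftrightarrow>
     (let m = dim_y P; N = dim_x P; M = num_rows P in
        0 < m \<and> 0 < N \<and> 0 < M \<and>
        cost_y P \<in> carrier_vec m \<and>
        cost_x P \<in> carrier_vec N \<and> cost_v P \<in> carrier_vec N \<and> cost_w P \<in> carrier_vec N \<and>
        mat_y P \<in> carrier_mat M m \<and>
        mat_x P \<in> carrier_mat M N \<and> mat_v P \<in> carrier_mat M N \<and> mat_w P \<in> carrier_mat M N \<and>
        rhs P \<in> carrier_vec M \<and>
        lower P \<le> upper P)"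

definition original_milp ::
  "milp_data \<Rightarrow> (real vec \<times> real vec \<times> real vec \<times> real vec) minimization" where
  "original_milp P =
     \<lparr> feasible_set = {(y, x, v, w).
         y \<in> binary_vec (dim_y P) \<and>
         x \<in> binary_vec (dim_x P) \<and>
         v \<in> carrier_vec (dim_x P) \<and>
         w \<in> carrier_vec (dim_x P) \<and>
         mat_y P *\<^sub>v y + mat_x P *\<^sub>v x + mat_v P *\<^sub>v v + mat_w P *\<^sub>v w \<le> rhs P \<and>
         lower P \<cdot>\<^sub>v x \<le> v \<and> v \<le> upper P \<cdot>\<^sub>v x \<and>
         0\<^sub>v (dim_x P) \<le> w},
       objective = (\<lambda>(y, x, v, w).
         cost_y P \<bullet> y + cost_x P \<bullet> x + cost_v P \<bullet> v + cost_w P \<bullet> w) \<rparr>"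

section \<open>Partition and profiles\<close>

record profile_data =
  block_len :: nat                        \<comment> \<open>\<open>\<delta>\<close>\<close>
  num_blocks :: nat                       \<comment> \<open>\<open>n\<close>\<close>
  num_X :: nat                            \<comment> \<open>\<open>K\<close>\<close>
  prof_X :: "nat \<Rightarrow> real vec"             \<comment> \<open>the argument is \<open>k\<close>\<close>
  num_V :: "nat \<Rightarrow> nat"                   \<comment> \<open>\<open>I\<close>, the argument is \<open>k\<close>\<close>
  prof_V :: "nat \<Rightarrow> nat \<Rightarrow> real vec"      \<comment> \<open>the arguments are \<open>j\<close>, \<open>k\<close>, in this order\<close>
  num_W :: nat                            \<comment> \<open>\<open>J\<close>\<close>
  prof_W :: "nat \<Rightarrow> real vec"             \<comment> \<open>the argument is \<open>j\<close>\<close>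

definition valid_profiles :: "milp_data \<Rightarrow> profile_data \<Rightarrow> bool" where
  "valid_profiles P Q \<longleftrightarrow>
     0 < block_len Q \<and> dim_x P = num_blocks Q * block_len Q \<and>
     (\<forall>k<num_X Q. prof_X Q k \<in> binary_vec (block_len Q)) \<and>
     (\<forall>k<num_X Q. \<forall>j<num_V Q k.
        prof_V Q j k \<in> carrier_vec (block_len Q) \<and>
        lower P \<cdot>\<^sub>v prof_X Q k \<le> prof_V Q j k \<and>
        prof_V Q j k \<le> upper P \<cdot>\<^sub>v prof_X Q k) \<and>
     (\<forall>j<num_W Q. prof_W Q j \<in> carrier_vec (block_len Q) \<and> 0\<^sub>v (block_len Q) \<le> prof_W Q j)"

definition X_mat :: "profile_data \<Rightarrow> real mat" where
  "X_mat Q = mat_of_cols (block_len Q) (map (prof_X Q) [0..<num_X Q])"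

definition V_mat :: "profile_data \<Rightarrow> real mat" where
  "V_mat Q = mat_of_cols (block_len Q)
     (concat (map (\<lambda>k. map (\<lambda>j. prof_V Q j k) [0..<num_V Q k]) [0..<num_X Q]))"

definition W_mat :: "profile_data \<Rightarrow> real mat" where
  "W_mat Q = mat_of_cols (block_len Q) (map (prof_W Q) [0..<num_W Q])"

section \<open>Blocks\<close>

definition vec_block :: "nat \<Rightarrow> real vec \<Rightarrow> nat \<Rightarrow> real vec" where
  "vec_block \<delta> u i = vec \<delta> (\<lambda>s. u $ (i * \<delta> + s))"

definition col_block :: "nat \<Rightarrow> real mat \<Rightarrow> nat \<Rightarrow> real mat" where
  "col_block \<delta> E i = mat (dim_row E) \<delta> (\<lambda>(r, s). E $$ (r, i * \<delta> + s))"

definition concat_vecs :: "nat \<Rightarrow> (nat \<Rightarrow> real vec) \<Rightarrow> real vec" where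
  "concat_vecs n u = vec_of_list (concat (map (\<lambda>i. list_of_vec (u i)) [0..<n]))"

definition concat_mats :: "nat \<Rightarrow> nat \<Rightarrow> (nat \<Rightarrow> real mat) \<Rightarrow> real mat" where
  "concat_mats M n E = mat_of_cols M (concat (map (\<lambda>i. cols (E i)) [0..<n]))"

text \<open>
  For \<open>E = [E\<^sub>0 : \<dots> : E\<^sub>n\<^sub>-\<^sub>1]\<close>, \<open>e = (e\<^sub>0, \<dots>, e\<^sub>n\<^sub>-\<^sub>1)\<close> and a profile matrix \<open>Z\<close>, these are
  \<open>[E\<^sub>0 Z : \<dots> : E\<^sub>n\<^sub>-\<^sub>1 Z]\<close> and the transpose of \<open>[e\<^sub>0\<^sup>T Z : \<dots> : e\<^sub>n\<^sub>-\<^sub>1\<^sup>T Z]\<close>.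
\<close>

definition agg_mat :: "milp_data \<Rightarrow> profile_data \<Rightarrow> real mat \<Rightarrow> real mat \<Rightarrow> real mat" where
  "agg_mat P Q E Z =
     concat_mats (num_rows P) (num_blocks Q) (\<lambda>i. col_block (block_len Q) E i * Z)"

definition agg_vec :: "profile_data \<Rightarrow> real vec \<Rightarrow> real mat \<Rightarrow> real vec" where
  "agg_vec Q e Z =
     concat_vecs (num_blocks Q) (\<lambda>i. transpose_mat Z *\<^sub>v vec_block (block_len Q) e i)"

section \<open>The semi-coarse MILP\<close>

text \<open>
  The coefficients are families \<open>xb i k\<close>, \<open>vb i j k\<close>, \<open>wb i j\<close>, of which only the entries with
  indices in range matter. The following definitions list them as vectors, in an order
  compatible with the columns of the aggregated matrices.
\<close>

definition vec_xb :: "profile_data \<Rightarrow> (nat \<Rightarrow> nat \<Rightarrow> real) \<Rightarrow> real vec" where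
  "vec_xb Q xb = concat_vecs (num_blocks Q) (\<lambda>i. vec (num_X Q) (xb i))"

definition vec_vb :: "profile_data \<Rightarrow> (nat \<Rightarrow> nat \<Rightarrow> nat \<Rightarrow> real) \<Rightarrow> real vec" where
  "vec_vb Q vb = concat_vecs (num_blocks Q)
     (\<lambda>i. concat_vecs (num_X Q) (\<lambda>k. vec (num_V Q k) (\<lambda>j. vb i j k)))"

definition vec_wb :: "profile_data \<Rightarrow> (nat \<Rightarrow> nat \<Rightarrow> real) \<Rightarrow> real vec" where
  "vec_wb Q wb = concat_vecs (num_blocks Q) (\<lambda>i. vec (num_W Q) (wb i))"

definition semi_coarse_milp ::
  "milp_data \<Rightarrow> profile_data \<Rightarrow>
     (real vec \<times> (nat \<Rightarrow> nat \<Rightarrow> real) \<times> (nat \<Rightarrow> nat \<Rightarrow> nat \<Rightarrow> real) \<times> (nat \<Rightarrow> nat \<Rightarrow> real)) minimization"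
where
  "semi_coarse_milp P Q =
     \<lparr> feasible_set = {(y, xb, vb, wb).
         mat_y P *\<^sub>v y
           + agg_mat P Q (mat_x P) (X_mat Q) *\<^sub>v vec_xb Q xb
           + agg_mat P Q (mat_v P) (V_mat Q) *\<^sub>v vec_vb Q vb
           + agg_mat P Q (mat_w P) (W_mat Q) *\<^sub>v vec_wb Q wb \<le> rhs P \<and>
         y \<in> binary_vec (dim_y P) \<and>
         (\<forall>i<num_blocks Q.
            (\<Sum>k<num_X Q. xb i k) \<le> 1 \<and>
            (\<forall>k<num_X Q. xb i k \<in> {0, 1}) \<and>
            (\<Sum>k<num_X Q. \<Sum>j<num_V Q k. vb i j k) \<le> 1 \<and>
            (\<forall>k<num_X Q. (\<Sum>j<num_V Q k. vb i j k) = xb i k) \<and>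
            (\<forall>k<num_X Q. \<forall>j<num_V Q k. 0 \<le> vb i j k \<and> vb i j k \<le> 1) \<and>
            (\<Sum>j<num_W Q. wb i j) \<le> 1 \<and>
            (\<forall>j<num_W Q. 0 \<le> wb i j \<and> wb i j \<le> 1))},
       objective = (\<lambda>(y, xb, vb, wb).
         cost_y P \<bullet> y
           + agg_vec Q (cost_x P) (X_mat Q) \<bullet> vec_xb Q xb
           + agg_vec Q (cost_v P) (V_mat Q) \<bullet> vec_vb Q vb
           + agg_vec Q (cost_w P) (W_mat Q) \<bullet> vec_wb Q wb) \<rparr>"

section \<open>Fine-scale variables\<close>

definition fine_x :: "profile_data \<Rightarrow> (nat \<Rightarrow> nat \<Rightarrow> real) \<Rightarrow> real vec" where
  "fine_x Q xb = concat_vecs (num_blocks Q)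
     (\<lambda>i. finsum_vec TYPE(real) (block_len Q) (\<lambda>k. xb i k \<cdot>\<^sub>v prof_X Q k) {..<num_X Q})"

definition fine_v :: "profile_data \<Rightarrow> (nat \<Rightarrow> nat \<Rightarrow> nat \<Rightarrow> real) \<Rightarrow> real vec" where
  "fine_v Q vb = concat_vecs (num_blocks Q)
     (\<lambda>i. finsum_vec TYPE(real) (block_len Q)
        (\<lambda>k. finsum_vec TYPE(real) (block_len Q) (\<lambda>j. vb i j k \<cdot>\<^sub>v prof_V Q j k) {..<num_V Q k})
        {..<num_X Q})"

definition fine_w :: "profile_data \<Rightarrow> (nat \<Rightarrow> nat \<Rightarrow> real) \<Rightarrow> real vec" where
  "fine_w Q wb = concat_vecs (num_blocks Q)
     (\<lambda>i. finsum_vec TYPE(real) (block_len Q) (\<lambda>j. wb i j \<cdot>\<^sub>v prof_W Q j) {..<num_W Q})"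

end

theory Submission
  imports Defs
begin

text \<open>
  A feasible point of the semi-coarse MILP encodes a fine-scale point whose blocks are combinations
  of the profiles. If \<open>Z\<close> is a profile matrix and \<open>u\<^sub>i\<close> collects the coefficients of block
  \<open>i\<close>, then the \<open>i\<close>-th fine-scale block is \<open>Z u\<^sub>i\<close>. Associativity
  \<open>(E\<^sub>i Z) u\<^sub>i = E\<^sub>i (Z u\<^sub>i)\<close>, summed over the blocks, shows that the aggregated matrix applied to the
  coefficients equals the original matrix applied to the fine-scale vector
  (\<open>agg_mat_mult_concat_vecs\<close>). Hence the coupling constraints of the two problems are literally the
  same.

  The remaining constraints hold block by block. At most one of the binary coefficients of a block
  is nonzero, so \<open>x\<^sub>i\<close> is zero or a single profile, and it is binary (\<open>selection_binary\<close>).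
  The bounds on \<open>v\<^sub>i\<close> are the bounds on the profiles, weighted by the nonnegative coefficients; the
  linking constraint \<open>\<Sum>\<^sub>j v\<^sub>i\<^sub>j\<^sub>k = x\<^sub>i\<^sub>k\<close> collects the weighted bounds into multiples of
  \<open>x\<^sub>i\<close> (\<open>linked_combination_bounds\<close>). Finally \<open>w\<^sub>i\<close> is a nonnegative combination of nonnegative
  profiles.
\<close>

section \<open>Concatenated blocks\<close>

lemma length_concat_blocks:
  assumes "\<And>i. i < n \<Longrightarrow> length (f i) = d"
  shows "length (concat (map f [0..<n])) = n * d"
  using assms by (induction n) auto

lemma nth_concat_blocks:
  assumes "\<And>i. i < n \<Longrightarrow> length (f i) = d" and "i < n" and "s < d"
  shows "concat (map f [0..<n]) ! (i * d + s) = f i ! s"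
  using assms
proof (induction n)
  case (Suc n)
  have len: "length (concat (map f [0..<n])) = n * d"
    using Suc.prems(1) by (intro length_concat_blocks) simp
  show ?case
  proof (cases "i = n")
    case True
    then show ?thesis using len by (simp add: nth_append)
  next
    case False
    with Suc.prems(2) have "i < n" by simp
    then have "Suc i * d \<le> n * d" by (intro mult_le_mono1) simp
    with Suc.prems(3) have "i * d + s < n * d" by simp
    then show ?thesis using Suc \<open>i < n\<close> len by (simp add: nth_append)
  qed
qed simp

lemma concat_vecs_carrier:
  assumes "\<And>i. i < n \<Longrightarrow> u i \<in> carrier_vec d"
  shows "concat_vecs n u \<in> carrier_vec (n * d)"
  using length_concat_blocks[of n "\<lambda>i. list_of_vec (u i)" d] carrier_vecD[OF assms]
  by (intro carrier_vecI) (simp add: concat_vecs_def)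

lemma index_concat_vecs:
  assumes "\<And>i. i < n \<Longrightarrow> u i \<in> carrier_vec d" and "i < n" and "s < d"
  shows "concat_vecs n u $ (i * d + s) = u i $ s"
  using nth_concat_blocks[of n "\<lambda>i. list_of_vec (u i)" d i s] assms(2,3) carrier_vecD[OF assms(1)]
  by (simp add: concat_vecs_def vec_of_list_index list_of_vec_index)

text \<open>
  This reduces componentwise claims about a concatenated vector to claims about each block.
\<close>

lemma all_less_mult_iff_blocks:
  fixes n d :: nat
  shows "(\<forall>p < n * d. R p) \<longleftrightarrow> (\<forall>i<n. \<forall>s<d. R (i * d + s))"
proof (intro iffI allI impI)
  fix i s assume all: "\<forall>p < n * d. R p" and "i < n" "s < d"
  have "Suc i * d \<le> n * d" using \<open>i < n\<close> by (intro mult_le_mono1) simp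
  with \<open>s < d\<close> have "i * d + s < n * d" by simp
  with all show "R (i * d + s)" by blast
next
  fix p assume blocks: "\<forall>i<n. \<forall>s<d. R (i * d + s)" and p: "p < n * d"
  then have "0 < d" by (cases d) auto
  then have "p div d < n" "p mod d < d"
    using p by (simp_all add: less_mult_imp_div_less)
  with blocks have "R (p div d * d + p mod d)" by blast
  then show "R p" by simp
qed

lemma binary_concat_vecs:
  assumes "\<And>i. i < n \<Longrightarrow> u i \<in> binary_vec d"
  shows "concat_vecs n u \<in> binary_vec (n * d)"
proof -
  have carrier: "u i \<in> carrier_vec d" if "i < n" for i
    using assms[OF that] by (simp add: binary_vec_def)
  have "\<forall>p < n * d. concat_vecs n u $ p \<in> {0, 1}"
    unfolding all_less_mult_iff_blocks
    using assms index_concat_vecs[of n u d, OF carrier] by (simp add: binary_vec_def)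
  then show ?thesis
    using concat_vecs_carrier[of n u d, OF carrier] by (simp add: binary_vec_def)
qed

lemma concat_vecs_mono:
  assumes u: "\<And>i. i < n \<Longrightarrow> u i \<in> carrier_vec d" and u': "\<And>i. i < n \<Longrightarrow> u' i \<in> carrier_vec d"
    and le: "\<And>i. i < n \<Longrightarrow> u i \<le> u' i"
  shows "concat_vecs n u \<le> concat_vecs n u'"
proof -
  have "u i $ s \<le> u' i $ s" if "i < n" "s < d" for i s
    using le[OF that(1)] u'[OF that(1)] that(2) by (auto simp: less_eq_vec_def)
  then have "\<forall>p < n * d. concat_vecs n u $ p \<le> concat_vecs n u' $ p"
    unfolding all_less_mult_iff_blocks
    using index_concat_vecs[of n u d, OF u] index_concat_vecs[of n u' d, OF u'] by simp
  then show ?thesis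
    using carrier_vecD[OF concat_vecs_carrier[of n u d, OF u]]
      carrier_vecD[OF concat_vecs_carrier[of n u' d, OF u']]
    by (simp add: less_eq_vec_def)
qed

lemma smult_concat_vecs:
  "a \<cdot>\<^sub>v concat_vecs n u = concat_vecs n (\<lambda>i. a \<cdot>\<^sub>v u i)"
proof -
  have "list_of_vec (a \<cdot>\<^sub>v z) = map ((*) a) (list_of_vec z)" for z :: "real vec"
    by (intro nth_equalityI) (simp_all add: list_of_vec_index)
  then have "concat_vecs n (\<lambda>i. a \<cdot>\<^sub>v u i)
      = vec_of_list (map ((*) a) (concat (map (\<lambda>i. list_of_vec (u i)) [0..<n])))"
    unfolding concat_vecs_def by (simp add: map_concat comp_def)
  also have "\<dots> = a \<cdot>\<^sub>v concat_vecs n u"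
    unfolding concat_vecs_def by (intro eq_vecI) (simp_all add: vec_of_list_index)
  finally show ?thesis by simp
qed

lemma concat_vecs_zero: "concat_vecs n (\<lambda>i. 0\<^sub>v d) = 0\<^sub>v (n * d)"
proof -
  have carrier: "concat_vecs n (\<lambda>i. 0\<^sub>v d) \<in> carrier_vec (n * d)"
    by (rule concat_vecs_carrier) simp
  have "\<forall>p < n * d. concat_vecs n (\<lambda>i. 0\<^sub>v d) $ p = 0"
    unfolding all_less_mult_iff_blocks
    using index_concat_vecs[of n "\<lambda>i. 0\<^sub>v d" d] by simp
  with carrier show ?thesis by (intro eq_vecI) auto
qed

section \<open>Block matrices and aggregation\<close>

lemma index_mat_of_cols_mult_vec_of_list:
  assumes "length xs = length ys" and "r < d"
  shows "(mat_of_cols d xs *\<^sub>v vec_of_list ys) $ r = sum_list (map2 (\<lambda>x c. x $ r * c) xs ys)"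
  using assms
  by (simp add: sum_list_sum_nth scalar_prod_def mat_of_cols_index vec_of_list_index)

lemma sum_list_map2_concat:
  assumes "\<And>i. i < n \<Longrightarrow> length (F i) = length (G i)"
  shows "sum_list (map2 g (concat (map F [0..<n])) (concat (map G [0..<n])))
    = (\<Sum>i<n. sum_list (map2 g (F i) (G i)))"
  using assms
proof (induction n)
  case (Suc n)
  have "map length (map F [0..<n]) = map length (map G [0..<n])"
    using Suc.prems by simp
  then have "length (concat (map F [0..<n])) = length (concat (map G [0..<n]))"
    unfolding length_concat by (rule arg_cong)
  then show ?case using Suc by simp
qed simp

text \<open>
  The blocks may have different widths, as happens for the profiles \<open>V\<^sub>j\<^sub>k\<close> grouped by \<open>k\<close>. The
  proof therefore pairs columns with entries as lists, where no global column index occurs.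
\<close>

lemma index_concat_mats_mult_concat_vecs:
  assumes E: "\<And>i. i < n \<Longrightarrow> E i \<in> carrier_mat M (dim_vec (u i))" and r: "r < M"
  shows "(concat_mats M n E *\<^sub>v concat_vecs n u) $ r = (\<Sum>i<n. (E i *\<^sub>v u i) $ r)"
proof -
  have len: "length (cols (E i)) = length (list_of_vec (u i))" if "i < n" for i
    using E[OF that] by simp
  have block: "sum_list (map2 (\<lambda>x c. x $ r * c) (cols (E i)) (list_of_vec (u i)))
      = (E i *\<^sub>v u i) $ r" if "i < n" for i
    using index_mat_of_cols_mult_vec_of_list[OF len[OF that] r] E[OF that]
      mat_of_cols_cols[of "E i"]
    by (simp add: vec_list)
  have "map length (map (\<lambda>i. cols (E i)) [0..<n]) = map length (map (\<lambda>i. list_of_vec (u i)) [0..<n])"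
    using len by simp
  then have "length (concat (map (\<lambda>i. cols (E i)) [0..<n]))
      = length (concat (map (\<lambda>i. list_of_vec (u i)) [0..<n]))"
    unfolding length_concat by (rule arg_cong)
  then have "(concat_mats M n E *\<^sub>v concat_vecs n u) $ r
      = sum_list (map2 (\<lambda>x c. x $ r * c) (concat (map (\<lambda>i. cols (E i)) [0..<n]))
          (concat (map (\<lambda>i. list_of_vec (u i)) [0..<n])))"
    unfolding concat_mats_def concat_vecs_def
    by (intro index_mat_of_cols_mult_vec_of_list r)
  also have "\<dots> = (\<Sum>i<n. (E i *\<^sub>v u i) $ r)"
    using block len by (simp add: sum_list_map2_concat)
  finally show ?thesis .
qed

lemma index_mult_concat_vecs:
  assumes E: "E \<in> carrier_mat M (n * d)" and u: "\<And>i. i < n \<Longrightarrow> u i \<in> carrier_vec d"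
    and r: "r < M"
  shows "(E *\<^sub>v concat_vecs n u) $ r = (\<Sum>i<n. (col_block d E i *\<^sub>v u i) $ r)"
proof -
  have shift: "(\<Sum>p = i * d..<i * d + d. g p) = (\<Sum>s<d. g (i * d + s))"
    for g :: "nat \<Rightarrow> real" and i
    using sum.shift_bounds_nat_ivl[of g 0 "i * d" d] by (simp add: atLeast0LessThan add.commute)
  have "(E *\<^sub>v concat_vecs n u) $ r = (\<Sum>p<n * d. E $$ (r, p) * concat_vecs n u $ p)"
    using E r concat_vecs_carrier[of n u d, OF u] by (simp add: scalar_prod_def atLeast0LessThan)
  also have "\<dots> = (\<Sum>i<n. \<Sum>p = i * d..<i * d + d. E $$ (r, p) * concat_vecs n u $ p)"
    by (rule sum.nat_group[symmetric])
  also have "\<dots> = (\<Sum>i<n. \<Sum>s<d. E $$ (r, i * d + s) * concat_vecs n u $ (i * d + s))"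
    by (simp only: shift)
  also have "\<dots> = (\<Sum>i<n. (col_block d E i *\<^sub>v u i) $ r)"
  proof (rule sum.cong)
    fix i assume "i \<in> {..<n}"
    then show "(\<Sum>s<d. E $$ (r, i * d + s) * concat_vecs n u $ (i * d + s))
        = (col_block d E i *\<^sub>v u i) $ r"
      using E r u[of i] index_concat_vecs[of n u d, OF u]
      by (simp add: col_block_def scalar_prod_def atLeast0LessThan)
  qed simp
  finally show ?thesis .
qed

text \<open>
  Both sides are \<open>\<Sum>\<^sub>i E\<^sub>i Z u\<^sub>i\<close>, bracketed in the two possible ways.
\<close>

lemma agg_mat_mult_concat_vecs:
  assumes E: "E \<in> carrier_mat (num_rows P) (num_blocks Q * block_len Q)"
    and Z: "Z \<in> carrier_mat (block_len Q) q"
    and u: "\<And>i. i < num_blocks Q \<Longrightarrow> u i \<in> carrier_vec q"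
  shows "agg_mat P Q E Z *\<^sub>v concat_vecs (num_blocks Q) u
    = E *\<^sub>v concat_vecs (num_blocks Q) (\<lambda>i. Z *\<^sub>v u i)"
proof (rule eq_vecI)
  show "dim_vec (agg_mat P Q E Z *\<^sub>v concat_vecs (num_blocks Q) u)
      = dim_vec (E *\<^sub>v concat_vecs (num_blocks Q) (\<lambda>i. Z *\<^sub>v u i))"
    using E by (simp add: agg_mat_def concat_mats_def)
next
  fix r assume "r < dim_vec (E *\<^sub>v concat_vecs (num_blocks Q) (\<lambda>i. Z *\<^sub>v u i))"
  then have r: "r < num_rows P" using E by simp
  have block: "col_block (block_len Q) E i \<in> carrier_mat (num_rows P) (block_len Q)" for i
    using E by (simp add: col_block_def)
  have "(agg_mat P Q E Z *\<^sub>v concat_vecs (num_blocks Q) u) $ r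
      = (\<Sum>i<num_blocks Q. (col_block (block_len Q) E i * Z *\<^sub>v u i) $ r)"
    unfolding agg_mat_def
  proof (rule index_concat_mats_mult_concat_vecs[OF _ r])
    fix i assume "i < num_blocks Q"
    then show "col_block (block_len Q) E i * Z \<in> carrier_mat (num_rows P) (dim_vec (u i))"
      using mult_carrier_mat[OF block[of i] Z] carrier_vecD[OF u[of i]] by simp
  qed
  also have "\<dots> = (\<Sum>i<num_blocks Q. (col_block (block_len Q) E i *\<^sub>v (Z *\<^sub>v u i)) $ r)"
    using assoc_mult_mat_vec[OF block Z] u by simp
  also have "\<dots> = (E *\<^sub>v concat_vecs (num_blocks Q) (\<lambda>i. Z *\<^sub>v u i)) $ r"
    using index_mult_concat_vecs[OF E _ r] mult_mat_vec_carrier[OF Z] u by simp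
  finally show "(agg_mat P Q E Z *\<^sub>v concat_vecs (num_blocks Q) u) $ r
      = (E *\<^sub>v concat_vecs (num_blocks Q) (\<lambda>i. Z *\<^sub>v u i)) $ r" .
qed

section \<open>Combinations of profiles\<close>

lemma combination_carrier:
  fixes K :: nat
  assumes "\<And>k. k < K \<Longrightarrow> p k \<in> carrier_vec d"
  shows "finsum_vec TYPE(real) d (\<lambda>k. c k \<cdot>\<^sub>v p k) {..<K} \<in> carrier_vec d"
  using assms by (intro finsum_vec_closed) auto

lemma index_combination:
  fixes K :: nat
  assumes "\<And>k. k < K \<Longrightarrow> p k \<in> carrier_vec d" and "s < d"
  shows "finsum_vec TYPE(real) d (\<lambda>k. c k \<cdot>\<^sub>v p k) {..<K} $ s = (\<Sum>k<K. c k * p k $ s)"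
proof -
  have "finsum_vec TYPE(real) d (\<lambda>k. c k \<cdot>\<^sub>v p k) {..<K} $ s = (\<Sum>k<K. (c k \<cdot>\<^sub>v p k) $ s)"
    using assms by (intro index_finsum_vec) auto
  also have "\<dots> = (\<Sum>k<K. c k * p k $ s)"
    using assms(2) carrier_vecD[OF assms(1)] by (intro sum.cong) simp_all
  finally show ?thesis .
qed

lemma mat_of_cols_mult_vec_eq_combination:
  assumes p: "\<And>k. k < K \<Longrightarrow> p k \<in> carrier_vec d"
  shows "mat_of_cols d (map p [0..<K]) *\<^sub>v vec K c
    = finsum_vec TYPE(real) d (\<lambda>k. c k \<cdot>\<^sub>v p k) {..<K}"
proof (rule eq_vecI)
  show "dim_vec (mat_of_cols d (map p [0..<K]) *\<^sub>v vec K c)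
      = dim_vec (finsum_vec TYPE(real) d (\<lambda>k. c k \<cdot>\<^sub>v p k) {..<K})"
    using carrier_vecD[OF combination_carrier[of K p d, OF p]] by simp
next
  fix s assume "s < dim_vec (finsum_vec TYPE(real) d (\<lambda>k. c k \<cdot>\<^sub>v p k) {..<K})"
  then have s: "s < d" using carrier_vecD[OF combination_carrier[of K p d, OF p]] by simp
  have "(mat_of_cols d (map p [0..<K]) *\<^sub>v vec K c) $ s = (\<Sum>k<K. c k * p k $ s)"
    using s by (simp add: scalar_prod_def mat_of_cols_index atLeast0LessThan mult.commute)
  then show "(mat_of_cols d (map p [0..<K]) *\<^sub>v vec K c) $ s
      = finsum_vec TYPE(real) d (\<lambda>k. c k \<cdot>\<^sub>v p k) {..<K} $ s"
    using index_combination[of K p d, OF p s] by simp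
qed

lemma double_combination_carrier:
  fixes K :: nat and I :: "nat \<Rightarrow> nat"
  assumes "\<And>k j. k < K \<Longrightarrow> j < I k \<Longrightarrow> p j k \<in> carrier_vec d"
  shows "finsum_vec TYPE(real) d
    (\<lambda>k. finsum_vec TYPE(real) d (\<lambda>j. c j k \<cdot>\<^sub>v p j k) {..<I k}) {..<K} \<in> carrier_vec d"
  using assms by (intro finsum_vec_closed Pi_I combination_carrier) auto

lemma index_double_combination:
  fixes K :: nat and I :: "nat \<Rightarrow> nat"
  assumes p: "\<And>k j. k < K \<Longrightarrow> j < I k \<Longrightarrow> p j k \<in> carrier_vec d" and s: "s < d"
  shows "finsum_vec TYPE(real) d
      (\<lambda>k. finsum_vec TYPE(real) d (\<lambda>j. c j k \<cdot>\<^sub>v p j k) {..<I k}) {..<K} $ s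
    = (\<Sum>k<K. \<Sum>j<I k. c j k * p j k $ s)"
proof -
  have "finsum_vec TYPE(real) d
      (\<lambda>k. finsum_vec TYPE(real) d (\<lambda>j. c j k \<cdot>\<^sub>v p j k) {..<I k}) {..<K} $ s
    = (\<Sum>k<K. finsum_vec TYPE(real) d (\<lambda>j. c j k \<cdot>\<^sub>v p j k) {..<I k} $ s)"
    using p s by (intro index_finsum_vec Pi_I combination_carrier) auto
  also have "\<dots> = (\<Sum>k<K. \<Sum>j<I k. c j k * p j k $ s)"
    using p s by (intro sum.cong index_combination) auto
  finally show ?thesis .
qed

text \<open>
  The columns are grouped by \<open>k\<close>, so the matrix is itself a concatenation of blocks, and block
  multiplication applies with \<open>k\<close> as the block index.
\<close>

lemma mat_of_concat_cols_mult_eq_double_combination: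
  assumes p: "\<And>k j. k < K \<Longrightarrow> j < I k \<Longrightarrow> p j k \<in> carrier_vec d"
  shows "mat_of_cols d (concat (map (\<lambda>k. map (\<lambda>j. p j k) [0..<I k]) [0..<K]))
      *\<^sub>v concat_vecs K (\<lambda>k. vec (I k) (\<lambda>j. c j k))
    = finsum_vec TYPE(real) d
        (\<lambda>k. finsum_vec TYPE(real) d (\<lambda>j. c j k \<cdot>\<^sub>v p j k) {..<I k}) {..<K}"
    (is "?Z *\<^sub>v ?u = ?F")
proof (rule eq_vecI)
  have F: "?F \<in> carrier_vec d" by (intro double_combination_carrier p)
  then show "dim_vec (?Z *\<^sub>v ?u) = dim_vec ?F" by simp
  let ?E = "\<lambda>k. mat_of_cols d (map (\<lambda>j. p j k) [0..<I k])"
  have "map (\<lambda>k. map (\<lambda>j. p j k) [0..<I k]) [0..<K] = map (\<lambda>k. cols (?E k)) [0..<K]"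
    using p by (auto intro!: cols_mat_of_cols[symmetric])
  then have Z: "?Z = concat_mats d K ?E" unfolding concat_mats_def by (rule arg_cong)
  fix s assume "s < dim_vec ?F"
  then have s: "s < d" using carrier_vecD[OF F] by simp
  have "(?Z *\<^sub>v ?u) $ s = (\<Sum>k<K. (?E k *\<^sub>v vec (I k) (\<lambda>j. c j k)) $ s)"
    unfolding Z using s by (intro index_concat_mats_mult_concat_vecs carrier_matI) simp_all
  also have "\<dots> = (\<Sum>k<K. \<Sum>j<I k. c j k * p j k $ s)"
  proof (rule sum.cong)
    fix k assume "k \<in> {..<K}"
    then have pk: "\<And>j. j < I k \<Longrightarrow> p j k \<in> carrier_vec d" using p by simp
    show "(?E k *\<^sub>v vec (I k) (\<lambda>j. c j k)) $ s = (\<Sum>j<I k. c j k * p j k $ s)"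
      using index_combination[of "I k" "\<lambda>j. p j k" d, OF pk s]
      by (simp add: mat_of_cols_mult_vec_eq_combination[OF pk])
  qed simp
  also have "\<dots> = ?F $ s" using index_double_combination[of K I p d s c] p s by simp
  finally show "(?Z *\<^sub>v ?u) $ s = ?F $ s" .
qed

text \<open>
  Two coefficients equal to \<open>1\<close> would have a sum above \<open>1\<close>, so the combination picks at most one
  of the vectors.
\<close>

lemma selection_binary:
  fixes K :: nat
  assumes p: "\<And>k. k < K \<Longrightarrow> p k \<in> binary_vec d"
    and c: "\<And>k. k < K \<Longrightarrow> c k \<in> {0, 1 :: real}" and sum: "(\<Sum>k<K. c k) \<le> 1"
  shows "finsum_vec TYPE(real) d (\<lambda>k. c k \<cdot>\<^sub>v p k) {..<K} \<in> binary_vec d"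
proof -
  have carrier: "p k \<in> carrier_vec d" if "k < K" for k
    using p[OF that] by (simp add: binary_vec_def)
  have "(\<Sum>k<K. c k * p k $ s) \<in> {0, 1}" if s: "s < d" for s
  proof (cases "\<exists>k<K. c k = 1")
    case False
    then have "c k = 0" if "k < K" for k using c[OF that] that by blast
    then show ?thesis by simp
  next
    case True
    then obtain l where l: "l < K" "c l = 1" by blast
    have nonneg: "0 \<le> c k" if "k \<in> {..<K} - {l}" for k using c[of k] that by auto
    have "(\<Sum>k<K. c k) = 1 + (\<Sum>k\<in>{..<K} - {l}. c k)"
      using l by (subst sum.remove[of _ l]) auto
    then have "(\<Sum>k\<in>{..<K} - {l}. c k) = 0"
      using sum sum_nonneg[of "{..<K} - {l}" c] nonneg by force
    then have "c k = 0" if "k \<in> {..<K} - {l}" for k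
      using that nonneg sum_nonneg_eq_0_iff[of "{..<K} - {l}" c] by blast
    then have "(\<Sum>k<K. c k * p k $ s) = p l $ s"
      using l by (subst sum.remove[of _ l]) auto
    then show ?thesis using p[OF l(1)] s by (simp add: binary_vec_def)
  qed
  then show ?thesis
    using combination_carrier[of K p d, OF carrier] index_combination[of K p d, OF carrier]
    by (simp add: binary_vec_def)
qed

text \<open>
  Weighting the bounds on \<open>p\<^sub>j\<^sub>k\<close> by \<open>c\<^sub>j\<^sub>k \<ge> 0\<close> and summing over \<open>j\<close> leaves the weight
  \<open>\<Sum>\<^sub>j c\<^sub>j\<^sub>k = e\<^sub>k\<close> on the bound \<open>q\<^sub>k\<close>, which is the weight of \<open>q\<^sub>k\<close> in the other combination.
\<close>

lemma linked_combination_bounds: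
  fixes a b :: real and K :: nat and I :: "nat \<Rightarrow> nat"
  assumes q: "\<And>k. k < K \<Longrightarrow> q k \<in> carrier_vec d"
    and p: "\<And>k j. k < K \<Longrightarrow> j < I k \<Longrightarrow> p j k \<in> carrier_vec d"
    and lower: "\<And>k j. k < K \<Longrightarrow> j < I k \<Longrightarrow> a \<cdot>\<^sub>v q k \<le> p j k"
    and upper: "\<And>k j. k < K \<Longrightarrow> j < I k \<Longrightarrow> p j k \<le> b \<cdot>\<^sub>v q k"
    and c: "\<And>k j. k < K \<Longrightarrow> j < I k \<Longrightarrow> 0 \<le> c j k"
    and link: "\<And>k. k < K \<Longrightarrow> (\<Sum>j<I k. c j k) = e k"
  defines "x \<equiv> finsum_vec TYPE(real) d (\<lambda>k. e k \<cdot>\<^sub>v q k) {..<K}"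
    and "v \<equiv> finsum_vec TYPE(real) d
      (\<lambda>k. finsum_vec TYPE(real) d (\<lambda>j. c j k \<cdot>\<^sub>v p j k) {..<I k}) {..<K}"
  shows "a \<cdot>\<^sub>v x \<le> v" and "v \<le> b \<cdot>\<^sub>v x"
proof -
  have x: "x \<in> carrier_vec d" unfolding x_def by (intro combination_carrier q)
  have v: "v \<in> carrier_vec d" unfolding v_def by (intro double_combination_carrier p)
  have scaled: "t * x $ s = (\<Sum>k<K. \<Sum>j<I k. c j k * (t * q k $ s))" if "s < d" for s t
  proof -
    have "t * x $ s = (\<Sum>k<K. e k * (t * q k $ s))"
      unfolding x_def using index_combination[of K q d s, OF q that]
      by (simp add: sum_distrib_left mult.left_commute)
    also have "\<dots> = (\<Sum>k<K. \<Sum>j<I k. c j k * (t * q k $ s))"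
      using link by (simp flip: sum_distrib_right)
    finally show ?thesis .
  qed
  have v_index: "v $ s = (\<Sum>k<K. \<Sum>j<I k. c j k * p j k $ s)" if "s < d" for s
    unfolding v_def using p that by (intro index_double_combination)
  have "a * q k $ s \<le> p j k $ s \<and> p j k $ s \<le> b * q k $ s" if "k < K" "j < I k" "s < d" for k j s
    using lower[OF that(1,2)] upper[OF that(1,2)] q[OF that(1)] p[OF that(1,2)] that(3)
    by (auto simp: less_eq_vec_def)
  then have "a * x $ s \<le> v $ s \<and> v $ s \<le> b * x $ s" if "s < d" for s
    unfolding scaled[OF that] v_index[OF that]
    using c that by (auto intro!: sum_mono mult_left_mono)
  then show "a \<cdot>\<^sub>v x \<le> v" and "v \<le> b \<cdot>\<^sub>v x"
    using x v by (auto simp: less_eq_vec_def)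
qed

lemma combination_nonneg:
  fixes K :: nat
  assumes p: "\<And>k. k < K \<Longrightarrow> p k \<in> carrier_vec d" and nonneg: "\<And>k. k < K \<Longrightarrow> 0\<^sub>v d \<le> p k"
    and c: "\<And>k. k < K \<Longrightarrow> 0 \<le> c k"
  shows "0\<^sub>v d \<le> finsum_vec TYPE(real) d (\<lambda>k. c k \<cdot>\<^sub>v p k) {..<K}"
proof -
  have "0 \<le> p k $ s" if "k < K" "s < d" for k s
    using nonneg[OF that(1)] p[OF that(1)] that(2) by (simp add: less_eq_vec_def)
  then have "0 \<le> (\<Sum>k<K. c k * p k $ s)" if "s < d" for s
    using c that by (intro sum_nonneg) simp
  then show ?thesis
    using carrier_vecD[OF combination_carrier[of K p d, OF p]] index_combination[of K p d, OF p]
    by (simp add: less_eq_vec_def)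
qed

section \<open>Feasibility of the fine-scale point\<close>

theorem proposition2p1:
  fixes P :: milp_data and Q :: profile_data
    and y :: "real vec"
    and xb :: "nat \<Rightarrow> nat \<Rightarrow> real" and vb :: "nat \<Rightarrow> nat \<Rightarrow> nat \<Rightarrow> real" and wb :: "nat \<Rightarrow> nat \<Rightarrow> real"
    and x v w :: "real vec"
  assumes "valid_milp P"
    and "valid_profiles P Q"
    and "(y, xb, vb, wb) \<in> feasible_set (semi_coarse_milp P Q)"
    and "x = fine_x Q xb" and "v = fine_v Q vb" and "w = fine_w Q wb"
  shows "(y, x, v, w) \<in> feasible_set (original_milp P)"
proof -
  let ?n = "num_blocks Q" and ?d = "block_len Q"
  have N: "dim_x P = ?n * ?d"
    and X: "\<And>k. k < num_X Q \<Longrightarrow> prof_X Q k \<in> binary_vec ?d"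
    and V: "\<And>k j. k < num_X Q \<Longrightarrow> j < num_V Q k \<Longrightarrow> prof_V Q j k \<in> carrier_vec ?d"
    and V_lower: "\<And>k j. k < num_X Q \<Longrightarrow> j < num_V Q k
      \<Longrightarrow> lower P \<cdot>\<^sub>v prof_X Q k \<le> prof_V Q j k"
    and V_upper: "\<And>k j. k < num_X Q \<Longrightarrow> j < num_V Q k
      \<Longrightarrow> prof_V Q j k \<le> upper P \<cdot>\<^sub>v prof_X Q k"
    and W: "\<And>j. j < num_W Q \<Longrightarrow> prof_W Q j \<in> carrier_vec ?d"
    and W_nonneg: "\<And>j. j < num_W Q \<Longrightarrow> 0\<^sub>v ?d \<le> prof_W Q j"
    using assms(2) by (auto simp: valid_profiles_def)
  have X': "\<And>k. k < num_X Q \<Longrightarrow> prof_X Q k \<in> carrier_vec ?d"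
    using X by (simp add: binary_vec_def)
  have mats: "mat_x P \<in> carrier_mat (num_rows P) (?n * ?d)"
      "mat_v P \<in> carrier_mat (num_rows P) (?n * ?d)" "mat_w P \<in> carrier_mat (num_rows P) (?n * ?d)"
    using assms(1) by (simp_all add: valid_milp_def Let_def N)
  have coupling: "mat_y P *\<^sub>v y
        + agg_mat P Q (mat_x P) (X_mat Q) *\<^sub>v vec_xb Q xb
        + agg_mat P Q (mat_v P) (V_mat Q) *\<^sub>v vec_vb Q vb
        + agg_mat P Q (mat_w P) (W_mat Q) *\<^sub>v vec_wb Q wb \<le> rhs P"
    and y: "y \<in> binary_vec (dim_y P)"
    and xb_sum: "\<And>i. i < ?n \<Longrightarrow> (\<Sum>k<num_X Q. xb i k) \<le> 1"
    and xb: "\<And>i k. i < ?n \<Longrightarrow> k < num_X Q \<Longrightarrow> xb i k \<in> {0, 1}"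
    and link: "\<And>i k. i < ?n \<Longrightarrow> k < num_X Q \<Longrightarrow> (\<Sum>j<num_V Q k. vb i j k) = xb i k"
    and vb: "\<And>i k j. i < ?n \<Longrightarrow> k < num_X Q \<Longrightarrow> j < num_V Q k \<Longrightarrow> 0 \<le> vb i j k"
    and wb: "\<And>i j. i < ?n \<Longrightarrow> j < num_W Q \<Longrightarrow> 0 \<le> wb i j"
    using assms(3) by (simp_all add: semi_coarse_milp_def)

  define xi where "xi = (\<lambda>i. finsum_vec TYPE(real) ?d (\<lambda>k. xb i k \<cdot>\<^sub>v prof_X Q k) {..<num_X Q})"
  define vi where "vi = (\<lambda>i. finsum_vec TYPE(real) ?d
    (\<lambda>k. finsum_vec TYPE(real) ?d (\<lambda>j. vb i j k \<cdot>\<^sub>v prof_V Q j k) {..<num_V Q k}) {..<num_X Q})"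
  define wi where "wi = (\<lambda>i. finsum_vec TYPE(real) ?d (\<lambda>j. wb i j \<cdot>\<^sub>v prof_W Q j) {..<num_W Q})"
  have x: "x = concat_vecs ?n xi" and v: "v = concat_vecs ?n vi" and w: "w = concat_vecs ?n wi"
    by (simp_all add: assms(4-6) fine_x_def fine_v_def fine_w_def xi_def vi_def wi_def)
  have xi: "xi i \<in> carrier_vec ?d" and vi: "vi i \<in> carrier_vec ?d" and wi: "wi i \<in> carrier_vec ?d" for i
    unfolding xi_def vi_def wi_def
    using X' V W by (auto intro!: combination_carrier double_combination_carrier)

  have "agg_mat P Q (mat_x P) (X_mat Q) *\<^sub>v vec_xb Q xb = mat_x P *\<^sub>v x"
  proof -
    have "X_mat Q *\<^sub>v vec (num_X Q) (xb i) = xi i" for i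
      unfolding X_mat_def xi_def
      by (intro mat_of_cols_mult_vec_eq_combination X')
    moreover have "X_mat Q \<in> carrier_mat (block_len Q) (num_X Q)"
      by (intro carrier_matI) (simp_all add: X_mat_def)
    ultimately show ?thesis
      unfolding vec_xb_def x by (subst agg_mat_mult_concat_vecs[OF mats(1)]) simp_all
  qed
  moreover have "agg_mat P Q (mat_v P) (V_mat Q) *\<^sub>v vec_vb Q vb = mat_v P *\<^sub>v v"
  proof -
    have "V_mat Q *\<^sub>v concat_vecs (num_X Q) (\<lambda>k. vec (num_V Q k) (\<lambda>j. vb i j k)) = vi i" for i
      unfolding V_mat_def vi_def
      by (intro mat_of_concat_cols_mult_eq_double_combination V)
    moreover have "V_mat Q \<in> carrier_mat (block_len Q) (\<Sum>k\<leftarrow>[0..<num_X Q]. num_V Q k)"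
      by (intro carrier_matI) (simp_all add: V_mat_def length_concat comp_def)
    moreover have "concat_vecs (num_X Q) (\<lambda>k. vec (num_V Q k) (\<lambda>j. vb i j k))
        \<in> carrier_vec (\<Sum>k\<leftarrow>[0..<num_X Q]. num_V Q k)" for i
      by (intro carrier_vecI) (simp add: concat_vecs_def length_concat comp_def)
    ultimately show ?thesis
      unfolding vec_vb_def v by (subst agg_mat_mult_concat_vecs[OF mats(2)]) simp_all
  qed
  moreover have "agg_mat P Q (mat_w P) (W_mat Q) *\<^sub>v vec_wb Q wb = mat_w P *\<^sub>v w"
  proof -
    have "W_mat Q *\<^sub>v vec (num_W Q) (wb i) = wi i" for i
      unfolding W_mat_def wi_def
      by (intro mat_of_cols_mult_vec_eq_combination W)
    moreover have "W_mat Q \<in> carrier_mat (block_len Q) (num_W Q)"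
      by (intro carrier_matI) (simp_all add: W_mat_def)
    ultimately show ?thesis
      unfolding vec_wb_def w by (subst agg_mat_mult_concat_vecs[OF mats(3)]) simp_all
  qed
  ultimately have fine_coupling:
    "mat_y P *\<^sub>v y + mat_x P *\<^sub>v x + mat_v P *\<^sub>v v + mat_w P *\<^sub>v w \<le> rhs P"
    using coupling by simp

  have x_binary: "x \<in> binary_vec (dim_x P)"
    unfolding x N xi_def by (intro binary_concat_vecs selection_binary X xb xb_sum)
  have carriers: "v \<in> carrier_vec (dim_x P)" "w \<in> carrier_vec (dim_x P)"
    unfolding v w N by (intro concat_vecs_carrier vi wi)+
  have bounds: "lower P \<cdot>\<^sub>v xi i \<le> vi i" "vi i \<le> upper P \<cdot>\<^sub>v xi i" if "i < ?n" for i
    unfolding xi_def vi_def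
    using X' V V_lower V_upper vb[OF that] link[OF that]
    by (intro linked_combination_bounds; blast)+
  have "lower P \<cdot>\<^sub>v x \<le> v" "v \<le> upper P \<cdot>\<^sub>v x"
    unfolding x v smult_concat_vecs
    by (auto intro!: concat_vecs_mono[where d = ?d] xi vi bounds)
  moreover have "0\<^sub>v (dim_x P) \<le> w"
  proof -
    have "0\<^sub>v ?d \<le> wi i" if "i < ?n" for i
      unfolding wi_def using wb[OF that] by (intro combination_nonneg W W_nonneg)
    then show ?thesis
      unfolding w N concat_vecs_zero[symmetric] using wi by (intro concat_vecs_mono[where d = ?d]) auto
  qed
  ultimately show ?thesis
    using y x_binary carriers fine_coupling by (simp add: original_milp_def)
qed

end
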